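(* Let $G(\boldsymbol{x})$ be a nonlinear $q\times q$ symmetric real polynomial matrix in $\boldsymbol{x}=(x_1,\ldots,x_n)$ and let $\mathbf{K}=\{\boldsymbol{x}\in\mathbb{R}^n\mid G(\boldsymbol{x})\succeq 0\}$. Suppose that (i) $\mathbf{K}$ is compact and $I_q-G(\boldsymbol{x})\succeq 0$ for all $\boldsymbol{x}\in\mathbf{K}$; and (ii) $\mathbb{R}[\boldsymbol{x}]=\mathcal{H}(G)-\mathcal{H}(G)$, i.e. every real polynomial is a difference of two elements of $\mathcal{H}(G)$. If a polynomial $f(\boldsymbol{x})\in\mathbb{R}[\boldsymbol{x}]$ is positive on $\mathbf{K}$, then $f\in\mathcal{H}(G)$.
   Context: $\mathbb{R}[\boldsymbol{x}]$ is the ring of real polynomials in $\boldsymbol{x}$; $\mathbb{N}$ is the set of nonnegative integers; $\mathbb{R}_+$ the nonnegative reals; $[m]=\{1,\ldots,m\}$; $I_q$ is the $q\times q$ identity matrix. $\mathbb{S}^{p}_+$ is the set of $p\times p$ real symmetric positive semidefinite matrices; $\langle A,B\rangle=\mathrm{tr}(A^{\intercal}B)$; $U^{\otimes k}=U\otimes\cdots\otimes U$ ($k$ times, Kronecker product). For nonlinear $G$ (i.e. not of the form $A_0+\sum_i A_ix_i$), let $\widetilde{G}(\boldsymbol{x})=\mathrm{diag}(G(\boldsymbol{x}),I_q-G(\boldsymbol{x}))$ (block-diagonal, size $2q\times 2q$) and $$\mathcal{H}(G):=\Big\{\lambda_0+\sum_{k=1}^m\langle\Lambda_k,\widetilde{G}(\boldsymbol{x})^{\otimes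 k}\rangle\ \Big|\ m\in\mathbb{N},\ \lambda_0\in\mathbb{R}_+,\ \Lambda_k\in\mathbb{S}^{(2q)^k}_+,\ k\in[m]\Big\}\subset\mathbb{R}[\boldsymbol{x}].$$ *)

theory Defs
  imports
    "HOL-Analysis.Analysis"
    "HOL-Library.Poly_Mapping"
    "Jordan_Normal_Form.Matrix"
begin

text \<open>Real polynomials in variables indexed by a finite type \<open>'n\<close> form the monoid algebra of
  the exponent vectors \<open>'n \<Rightarrow>\<^sub>0 nat\<close> over the reals.\<close>

type_synonym 'n rpoly = "('n \<Rightarrow>\<^sub>0 nat) \<Rightarrow>\<^sub>0 real"

definition pconst :: "real \<Rightarrow> 'n rpoly" where
  "pconst c = Poly_Mapping.single 0 c"

definition pvar :: "'n \<Rightarrow> 'n rpoly" where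
  "pvar i = Poly_Mapping.single (Poly_Mapping.single i 1) 1"

definition peval :: "'n::finite rpoly \<Rightarrow> real ^ 'n \<Rightarrow> real" where
  "peval f x = (\<Sum>m\<in>Poly_Mapping.keys f.
     Poly_Mapping.lookup f m * (\<Prod>i\<in>UNIV. vec_nth x i ^ Poly_Mapping.lookup m i))"

definition pmat_eval :: "'n::finite rpoly mat \<Rightarrow> real ^ 'n \<Rightarrow> real mat" where
  "pmat_eval G x = map_mat (\<lambda>p. peval p x) G"

definition psd_mats :: "nat \<Rightarrow> real mat set" where
  "psd_mats p = {A \<in> carrier_mat p p. transpose_mat A = A \<and>
     (\<forall>v\<in>carrier_vec p. 0 \<le> scalar_prod v (A *\<^sub>v v))}"

definition linear_pmat :: "nat \<Rightarrow> 'n::finite rpoly mat \<Rightarrow> bool" where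
  "linear_pmat q G \<longleftrightarrow> (\<exists>A0\<in>carrier_mat q q. \<exists>A. (\<forall>i. A i \<in> carrier_mat q q) \<and>
     G = mat q q (\<lambda>rc. pconst (A0 $$ rc) + (\<Sum>i\<in>UNIV. pconst (A i $$ rc) * pvar i)))"

definition frob :: "'a::comm_semiring_1 mat \<Rightarrow> 'a mat \<Rightarrow> 'a" where
  "frob A B = (let C = transpose_mat A * B in \<Sum>i<dim_row C. C $$ (i, i))"

definition kron :: "'a::comm_semiring_1 mat \<Rightarrow> 'a mat \<Rightarrow> 'a mat" where
  "kron A B = mat (dim_row A * dim_row B) (dim_col A * dim_col B)
     (\<lambda>(i, j). A $$ (i div dim_row B, j div dim_col B) * B $$ (i mod dim_row B, j mod dim_col B))"

fun kron_pow :: "'a::comm_semiring_1 mat \<Rightarrow> nat \<Rightarrow> 'a mat" where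
  "kron_pow U 0 = 1\<^sub>m 1"
| "kron_pow U (Suc k) = kron U (kron_pow U k)"

definition Gtilde :: "'n rpoly mat \<Rightarrow> 'n rpoly mat" where
  "Gtilde G = diag_block_mat [G, 1\<^sub>m (dim_row G) - G]"

text \<open>The real matrices \<open>\<Lambda> k\<close> enter the pairing as matrices of constant polynomials, so that
  the elements of \<open>HG G\<close> are formal polynomials.\<close>

definition HG :: "'n rpoly mat \<Rightarrow> 'n rpoly set" where
  "HG G = {pconst l0 + (\<Sum>k=1..m. frob (map_mat pconst (\<Lambda> k)) (kron_pow (Gtilde G) k)) | l0 m \<Lambda>.
     0 \<le> l0 \<and> (\<forall>k\<in>{1..m}. \<Lambda> k \<in> psd_mats ((2 * dim_row G) ^ k))}"

end

theory Submission
  imports Defs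
begin

text \<open>
  The theorem is an instance of the Kadison--Dubois representation theorem. Write \<open>U\<close> for
  \<open>Gtilde G\<close> and let \<open>T\<close> (\<open>kron_cone\<close>) be the cone of all finite sums of quadratic forms
  \<open>v\<^sup>T U\<^bsup>\<otimes>k\<^esup> v\<close> with real coefficient vectors \<open>v\<close>. Since \<open>v v\<^sup>T\<close> is positive semidefinite,
  \<open>T\<close> lies in \<open>HG G\<close>, so it suffices to find \<open>f\<close> in \<open>T\<close>.

  \<^item> \<open>T\<close> is a semiring, because a product of two such forms is the form of the vector
    \<open>v \<otimes> w\<close> (\<open>kron_form_mult\<close>).

  \<^item> \<open>T\<close> is Archimedean: every polynomial is dominated, modulo \<open>T\<close>, by a constant. For a single
    form this is Lagrange's identity, which writes \<open>\<bar>v\<bar>\<^sup>2 I - v v\<^sup>T\<close> as a sum of rank-one squares, together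
    with the fact that \<open>\<langle>I, U\<^bsup>\<otimes>k\<^esup>\<rangle>\<close> is the constant \<open>q\<^sup>k\<close>: the diagonal blocks \<open>G\<close> and \<open>1 - G\<close>
    have traces adding up to \<open>q\<close> (\<open>norm_bound_kron_form\<close>, \<open>trace_Gtilde\<close>). Polarization spreads the
    bound to all of \<open>HG G\<close> (\<open>HG_subset_kron_bounded\<close>), and hypothesis (ii) to all polynomials.

  \<^item> In an Archimedean semiring an element that is positive under every ring homomorphism to the
    reals that is nonnegative on the semiring belongs to the semiring
    (\<open>positive_on_characters_imp_mem\<close>).

  \<^item> Such a homomorphism of the polynomial ring is evaluation at a point \<open>x\<close>, and nonnegativity on the
    forms with \<open>k = 1\<close> says in particular that \<open>G x\<close> is positive semidefinite, so \<open>x\<close> is in \<open>K\<close>, where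
    \<open>f\<close> is positive (\<open>ring_hom_eq_peval\<close>, \<open>pmat_eval_psd_of_ring_hom\<close>).
\<close>

section \<open>Archimedean semirings\<close>

locale archimedean_semiring =
  fixes c :: "real \<Rightarrow> 'a::comm_ring_1" and T :: "'a set"
  assumes c_one: "c 1 = 1"
    and c_add: "c (r + s) = c r + c s"
    and c_mult: "c (r * s) = c r * c s"
    and const_mem: "0 \<le> r \<Longrightarrow> c r \<in> T"
    and add_mem: "a \<in> T \<Longrightarrow> b \<in> T \<Longrightarrow> a + b \<in> T"
    and mult_mem: "a \<in> T \<Longrightarrow> b \<in> T \<Longrightarrow> a * b \<in> T"
    and archimedean: "\<exists>r. c r - a \<in> T"
begin

definition character :: "('a \<Rightarrow> real) \<Rightarrow> bool" where
  "character \<phi> \<longleftrightarrow> (\<forall>a b. \<phi> (a + b) = \<phi> a + \<phi> b) \<and> (\<forall>a b. \<phi> (a * b) = \<phi> a * \<phi> b) \<and>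
     (\<forall>r. \<phi> (c r) = r) \<and> (\<forall>t\<in>T. 0 \<le> \<phi> t)"

text \<open>The set of nonnegative elements of a nontrivial preorder on the additive group for which
  multiplication by a member of \<open>T\<close> is monotone. Closure under multiplication is not part of the
  definition because the module that matters, \<open>T - f T\<close>, generally lacks it.\<close>

definition proper_module :: "'a set \<Rightarrow> bool" where
  "proper_module M \<longleftrightarrow> 1 \<in> M \<and> -1 \<notin> M \<and> (\<forall>a\<in>M. \<forall>b\<in>M. a + b \<in> M) \<and> (\<forall>t\<in>T. \<forall>a\<in>M. t * a \<in> M)"

lemma c_zero: "c 0 = 0"
  using c_add[of 0 0] by simp

lemma c_minus: "c (- r) = - c r"
  using c_add[of r "- r"] by (simp add: c_zero eq_neg_iff_add_eq_0 add.commute)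

lemma c_diff: "c (r - s) = c r - c s"
  using c_add[of r "- s"] by (simp add: c_minus)

lemma zero_mem: "0 \<in> T" and one_mem: "1 \<in> T"
  using const_mem[of 0] const_mem[of 1] by (simp_all add: c_zero c_one)

lemma archimedean_gt: "\<exists>r>s. c r - a \<in> T"
proof -
  obtain r where r: "c r - a \<in> T"
    using archimedean by blast
  have "c r - a + c (max r (s + 1) - r) \<in> T"
    by (intro add_mem r const_mem) simp
  then have "c (max r (s + 1)) - a \<in> T"
    by (simp add: c_diff)
  then show ?thesis
    by (intro exI[of _ "max r (s + 1)"]) auto
qed

text \<open>This is what upgrades closure under multiplication by \<open>T\<close> to closure under multiplication by the
  whole ring, for instance in \<open>module_mult_closed\<close>, where \<open>M \<inter> - M\<close> turns out to be an ideal.\<close>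

lemma difference_of_members: "\<exists>s\<in>T. \<exists>t\<in>T. a = s - t"
proof -
  obtain r where r: "r > 0" "c r - a \<in> T"
    using archimedean_gt by blast
  have "a = c r - (c r - a)"
    by simp
  then show ?thesis
    using r const_mem[of r] by (metis less_imp_le)
qed

lemma module_mult_closed:
  assumes "\<And>a b. a \<in> M \<Longrightarrow> b \<in> M \<Longrightarrow> a + b \<in> M" and "\<And>t a. t \<in> T \<Longrightarrow> a \<in> M \<Longrightarrow> t * a \<in> M"
    and "a \<in> M" and "- a \<in> M"
  shows "b * a \<in> M"
proof -
  obtain s t where st: "s \<in> T" "t \<in> T" "b = s - t"
    using difference_of_members by blast
  have "s * a + t * (- a) \<in> M"
    using assms st by blast
  then show ?thesis
    by (simp add: st(3) left_diff_distrib)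
qed

text \<open>Zorn's lemma gives a maximal \<open>N\<close>. If neither \<open>a\<close> nor \<open>-a\<close> were in \<open>N\<close>, then \<open>-1\<close> would be both
  \<open>m + t a\<close> and \<open>m' - t' a\<close>. Eliminating \<open>a\<close> between the two equations shows that \<open>-t\<close> is in \<open>N\<close>; hence
  \<open>t\<close> lies in the ideal \<open>N \<inter> - N\<close>, so does \<open>t a\<close>, and \<open>-1 = m + t a\<close> is in \<open>N\<close>.\<close>

lemma maximal_proper_module:
  assumes "proper_module M"
  obtains N where "proper_module N" "M \<subseteq> N" "\<And>a. a \<in> N \<or> - a \<in> N"
proof -
  let ?P = "{N. proper_module N \<and> M \<subseteq> N}"
  have "\<exists>N\<in>?P. \<forall>X\<in>?P. N \<subseteq> X \<longrightarrow> X = N"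
  proof (rule subset_Zorn_nonempty)
    show "?P \<noteq> {}"
      using assms by blast
  next
    fix C assume C: "C \<noteq> {}" "subset.chain ?P C"
    then have sub: "\<And>X. X \<in> C \<Longrightarrow> proper_module X \<and> M \<subseteq> X"
      unfolding subset.chain_def by blast
    have chain: "X \<subseteq> Y \<or> Y \<subseteq> X" if "X \<in> C" "Y \<in> C" for X Y
      using C that unfolding subset.chain_def by blast
    have "a + b \<in> \<Union>C" if "a \<in> \<Union>C" "b \<in> \<Union>C" for a b
    proof -
      obtain X Y where XY: "a \<in> X" "X \<in> C" "b \<in> Y" "Y \<in> C"
        using \<open>a \<in> \<Union>C\<close> \<open>b \<in> \<Union>C\<close> by blast
      with chain[of X Y] have "\<exists>Z\<in>C. a \<in> Z \<and> b \<in> Z"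
        by blast
      then show ?thesis
        using sub unfolding proper_module_def by blast
    qed
    then have "proper_module (\<Union>C)"
      using sub C(1) unfolding proper_module_def by blast
    then show "\<Union>C \<in> ?P"
      using sub C(1) by blast
  qed
  then obtain N where N: "proper_module N" "M \<subseteq> N"
    and max: "\<And>X. proper_module X \<Longrightarrow> N \<subseteq> X \<Longrightarrow> X = N"
    by (smt (verit) mem_Collect_eq order_trans)
  have one: "1 \<in> N" and neg: "-1 \<notin> N"
    and add: "\<And>a b. a \<in> N \<Longrightarrow> b \<in> N \<Longrightarrow> a + b \<in> N"
    and mult: "\<And>t a. t \<in> T \<Longrightarrow> a \<in> N \<Longrightarrow> t * a \<in> N"
    using N(1) unfolding proper_module_def by blast+
  have T: "t \<in> N" if "t \<in> T" for t
    using mult[OF that one] by simp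
  \<comment> \<open>otherwise \<open>N + T a\<close> would be a larger proper module\<close>
  have ext: "\<exists>m\<in>N. \<exists>t\<in>T. -1 = m + t * a" if "a \<notin> N" for a
  proof (rule ccontr)
    assume contra: "\<not> ?thesis"
    define X where "X = {m + t * a | m t. m \<in> N \<and> t \<in> T}"
    have XI: "m + t * a \<in> X" if "m \<in> N" "t \<in> T" for m t
      using that unfolding X_def by blast
    have sub: "N \<subseteq> X"
      using XI[OF _ zero_mem] by auto
    have "0 + 1 * a \<in> X"
      by (rule XI) (use T zero_mem one_mem in auto)
    then have aX: "a \<in> X"
      by simp
    have "u + v \<in> X" if "u \<in> X" "v \<in> X" for u v
    proof -
      obtain m t where "u = m + t * a" "m \<in> N" "t \<in> T"
        using \<open>u \<in> X\<close> unfolding X_def by blast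
      moreover obtain m' t' where "v = m' + t' * a" "m' \<in> N" "t' \<in> T"
        using \<open>v \<in> X\<close> unfolding X_def by blast
      ultimately show ?thesis
        using XI[of "m + m'" "t + t'"] add add_mem by (simp add: algebra_simps)
    qed
    moreover have "s * u \<in> X" if "s \<in> T" "u \<in> X" for s u
    proof -
      obtain m t where "u = m + t * a" "m \<in> N" "t \<in> T"
        using \<open>u \<in> X\<close> unfolding X_def by blast
      then show ?thesis
        using XI[of "s * m" "s * t"] mult[of s m] mult_mem[of s t] \<open>s \<in> T\<close>
        by (simp add: distrib_left mult.assoc)
    qed
    moreover have "-1 \<notin> X"
      using contra unfolding X_def by blast
    ultimately have "proper_module X"
      unfolding proper_module_def using sub one by blast
    then show False
      using max sub aX that by blast
  qed
  have "a \<in> N \<or> - a \<in> N" for a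
  proof (rule ccontr)
    assume "\<not> ?thesis"
    then obtain m t m' t' where m: "m \<in> N" "t \<in> T" "-1 = m + t * a"
      and m': "m' \<in> N" "t' \<in> T" "-1 = m' + t' * (- a)"
      using ext by metis
    have "t' + (t' * m + t * m') = t' * (m + t * a) + t * (m' + t' * (- a)) + t'"
      by (simp add: algebra_simps)
    also have "\<dots> = - t"
      unfolding m(3)[symmetric] m'(3)[symmetric] by simp
    finally have "- t \<in> N"
      using T add mult m m' by metis
    then have "a * t \<in> N"
      using module_mult_closed[of N t a] add mult T m by blast
    then have "-1 \<in> N"
      using add m by (metis mult.commute)
    then show False
      using neg by blast
  qed
  then show thesis
    using that N by blast
qed

text \<open>Enlarge the module to a total one. It defines a total preorder of the ring in which every element
  lies between two scalars, so that \<open>a\<close> can be measured by a Dedekind cut of scalars: \<open>\<phi> a\<close> is the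
  supremum of the scalars below \<open>a\<close>. Additivity is immediate from the cut. The elements with
  \<open>\<phi> a = 0\<close> are the infinitesimal ones, and multiplying by a member of \<open>T\<close>, being bounded by a scalar,
  keeps them infinitesimal; so the kernel of \<open>\<phi>\<close> is an ideal, which makes \<open>\<phi>\<close> multiplicative.\<close>

lemma character_of_proper_module:
  assumes "proper_module M"
  obtains \<phi> where "character \<phi>" "\<And>a. a \<in> M \<Longrightarrow> 0 \<le> \<phi> a"
proof -
  obtain N where N: "proper_module N" "M \<subseteq> N" and total: "\<And>a. a \<in> N \<or> - a \<in> N"
    using maximal_proper_module[OF assms] by blast
  have one: "1 \<in> N" and neg: "-1 \<notin> N"
    and add: "\<And>a b. a \<in> N \<Longrightarrow> b \<in> N \<Longrightarrow> a + b \<in> N"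
    and mult: "\<And>t a. t \<in> T \<Longrightarrow> a \<in> N \<Longrightarrow> t * a \<in> N"
    using N(1) unfolding proper_module_def by blast+
  have T: "t \<in> N" if "t \<in> T" for t
    using mult[OF that one] by simp
  have c_nonneg: "0 \<le> r" if "c r \<in> N" for r
  proof (rule ccontr)
    assume "\<not> 0 \<le> r"
    then have "c (1 / - r) * c r \<in> N"
      using that by (intro mult const_mem) auto
    moreover have "c (1 / - r) * c r = -1"
      using \<open>\<not> 0 \<le> r\<close> c_minus[of 1] by (simp add: c_one flip: c_mult)
    ultimately show False
      using neg by simp
  qed
  define \<phi> where "\<phi> a = Sup {r. a - c r \<in> N}" for a
  have sandwich: "s \<le> r" if "a - c s \<in> N" "c r - a \<in> N" for a r s
    using c_nonneg[of "r - s"] add[OF that] by (simp add: c_diff)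
  have bdd: "bdd_above {r. a - c r \<in> N}" for a
  proof -
    obtain R where "c R - a \<in> T"
      using archimedean by blast
    then show ?thesis
      by (intro bdd_aboveI[of _ R]) (use sandwich T in blast)
  qed
  have nonempty: "{r. a - c r \<in> N} \<noteq> {}" for a
  proof -
    obtain R where "c R - (- a) \<in> T"
      using archimedean by blast
    then have "a - c (- R) \<in> N"
      using T by (simp add: c_minus add.commute)
    then show ?thesis
      by blast
  qed
  have lower: "r \<le> \<phi> a" if "a - c r \<in> N" for a r
    unfolding \<phi>_def by (rule cSup_upper[OF _ bdd]) (use that in simp)
  have upper: "\<phi> a \<le> r" if "c r - a \<in> N" for a r
    unfolding \<phi>_def by (rule cSup_least[OF nonempty]) (use that sandwich in blast)
  have below: "a - c r \<in> N" if less: "r < \<phi> a" for a r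
  proof -
    obtain s where s: "a - c s \<in> N" "r < s"
      using less_cSupD[OF nonempty less[unfolded \<phi>_def]] by auto
    have "a - c s + c (s - r) \<in> N"
      by (intro add s T const_mem) (use s in simp)
    then show ?thesis
      by (simp add: c_diff)
  qed
  have above: "c r - a \<in> N" if "\<phi> a < r" for a r
    using total[of "c r - a"] lower[of a r] that by force
  have \<phi>_const: "\<phi> (c r) = r" for r
    using lower[of "c r" r] upper[of r "c r"] T zero_mem by (simp add: antisym)
  have \<phi>_add: "\<phi> (a + b) = \<phi> a + \<phi> b" for a b
  proof (rule antisym; rule field_le_epsilon)
    fix e :: real assume e: "0 < e"
    have "(c (\<phi> a + e / 2) - a) + (c (\<phi> b + e / 2) - b) \<in> N"
      by (intro add above) (use e in auto)
    then have "c ((\<phi> a + e / 2) + (\<phi> b + e / 2)) - (a + b) \<in> N"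
      unfolding c_add by (simp add: algebra_simps)
    from upper[OF this] show "\<phi> (a + b) \<le> \<phi> a + \<phi> b + e"
      by simp
    have "(a - c (\<phi> a - e / 2)) + (b - c (\<phi> b - e / 2)) \<in> N"
      by (intro add below) (use e in auto)
    then have "(a + b) - c ((\<phi> a - e / 2) + (\<phi> b - e / 2)) \<in> N"
      unfolding c_add by (simp add: algebra_simps)
    from lower[OF this] show "\<phi> a + \<phi> b \<le> \<phi> (a + b) + e"
      by simp
  qed
  have \<phi>_minus: "\<phi> (- a) = - \<phi> a" for a
    using \<phi>_add[of a "- a"] \<phi>_const[of 0] by (simp add: c_zero)
  have \<phi>_diff: "\<phi> (a - b) = \<phi> a - \<phi> b" for a b
    using \<phi>_add[of a "- b"] by (simp add: \<phi>_minus)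
  have ker_upper: "\<phi> (t * a) \<le> 0" if "\<phi> a = 0" "t \<in> T" for a t
  proof (rule field_le_epsilon)
    fix e :: real assume e: "0 < e"
    obtain R where R: "R > 0" "c R - t \<in> T"
      using archimedean_gt by blast
    have "c (e / R) - a \<in> N"
      by (rule above) (use that e R in simp)
    \<comment> \<open>\<open>t a \<le> (e / R) t \<le> e\<close>\<close>
    then have "t * (c (e / R) - a) + c (e / R) * (c R - t) \<in> N"
      by (intro add mult[OF \<open>t \<in> T\<close>] T[OF mult_mem] \<open>c (e / R) - a \<in> N\<close> R(2) const_mem)
         (use e R in auto)
    moreover have "t * (c (e / R) - a) + c (e / R) * (c R - t) = c (e / R * R) - t * a"
      unfolding c_mult by (simp add: algebra_simps)
    ultimately show "\<phi> (t * a) \<le> 0 + e"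
      using upper[of e "t * a"] R by simp
  qed
  have ker_T: "\<phi> (t * a) = 0" if "\<phi> a = 0" "t \<in> T" for a t
    using ker_upper[of a t] ker_upper[of "- a" t] that by (simp add: \<phi>_minus)
  have ker: "\<phi> (b * a) = 0" if "\<phi> a = 0" for a b
  proof -
    obtain s t where "s \<in> T" "t \<in> T" "b = s - t"
      using difference_of_members by blast
    then show ?thesis
      using ker_T[OF that] by (simp add: left_diff_distrib \<phi>_diff)
  qed
  have \<phi>_scale: "\<phi> (c r * b) = r * \<phi> b" for r b
    using ker[of "b - c (\<phi> b)" "c r"]
    by (simp add: \<phi>_diff \<phi>_const right_diff_distrib flip: c_mult)
  have \<phi>_mult: "\<phi> (a * b) = \<phi> a * \<phi> b" for a b
    using ker[of "a - c (\<phi> a)" b]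
    by (simp add: \<phi>_diff \<phi>_const right_diff_distrib \<phi>_scale mult.commute[of b])
  have nonneg: "0 \<le> \<phi> a" if "a \<in> N" for a
    using lower[of a 0] that by (simp add: c_zero)
  show thesis
    by (rule that[of \<phi>]) (use \<phi>_add \<phi>_mult \<phi>_const nonneg T N(2) in \<open>auto simp: character_def\<close>)
qed

text \<open>If \<open>-1\<close> were not in the module \<open>T - f T\<close>, some character would be nonnegative on it, hence
  nonpositive at \<open>f\<close>. So \<open>f s = 1 + t\<close> with \<open>s\<close>, \<open>t\<close> in \<open>T\<close>. Starting from a scalar \<open>r\<close> with \<open>f + r\<close>
  in \<open>T\<close>, this equation allows one to lower \<open>r\<close> by a fixed amount \<open>1/N\<close> as long as \<open>r\<close> is nonnegative:
  if \<open>N - s\<close> is in \<open>T\<close>, then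
  \<open>N (f + r) - 1 = (N - s) (f + r) + t + r s\<close>
  is in \<open>T\<close>. After finitely many steps \<open>r = 0\<close> is reached.\<close>

theorem positive_on_characters_imp_mem:
  assumes pos: "\<And>\<phi>. character \<phi> \<Longrightarrow> 0 < \<phi> f"
  shows "f \<in> T"
proof -
  have "\<exists>s\<in>T. \<exists>t\<in>T. f * s = 1 + t"
  proof (rule ccontr)
    assume contra: "\<not> ?thesis"
    define M where "M = {t - f * s | s t. s \<in> T \<and> t \<in> T}"
    have MI: "t - f * s \<in> M" if "s \<in> T" "t \<in> T" for s t
      using that unfolding M_def by blast
    have "a + b \<in> M" if "a \<in> M" "b \<in> M" for a b
    proof -
      obtain s t where "a = t - f * s" "s \<in> T" "t \<in> T"
        using \<open>a \<in> M\<close> unfolding M_def by blast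
      moreover obtain s' t' where "b = t' - f * s'" "s' \<in> T" "t' \<in> T"
        using \<open>b \<in> M\<close> unfolding M_def by blast
      ultimately have "a + b = (t + t') - f * (s + s')" "s + s' \<in> T" "t + t' \<in> T"
        by (simp_all only: add_mem) (simp add: algebra_simps)
      then show ?thesis
        using MI by simp
    qed
    moreover have "u * a \<in> M" if "u \<in> T" "a \<in> M" for u a
    proof -
      obtain s t where "a = t - f * s" "s \<in> T" "t \<in> T"
        using \<open>a \<in> M\<close> unfolding M_def by blast
      then show ?thesis
        using MI[of "u * s" "u * t"] mult_mem \<open>u \<in> T\<close> by (simp add: right_diff_distrib mult.left_commute)
    qed
    moreover have "-1 \<notin> M"
    proof
      assume "-1 \<in> M"
      then obtain s t where "s \<in> T" "t \<in> T" "-1 = t - f * s"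
        unfolding M_def by blast
      moreover from this have "f * s = 1 + t"
        by (simp add: algebra_simps)
      ultimately show False
        using contra by blast
    qed
    moreover have "1 \<in> M"
      using MI[OF zero_mem one_mem] by simp
    ultimately have "proper_module M"
      unfolding proper_module_def by blast
    then obtain \<phi> where \<phi>: "character \<phi>" "\<And>a. a \<in> M \<Longrightarrow> 0 \<le> \<phi> a"
      using character_of_proper_module by blast
    have "- f \<in> M"
      using MI[OF one_mem zero_mem] by simp
    then have "0 \<le> \<phi> (- f)"
      by (rule \<phi>(2))
    moreover have "\<phi> (f + - f) = \<phi> f + \<phi> (- f)" "\<phi> (c 0) = 0"
      using \<phi>(1) unfolding character_def by blast+
    ultimately show False
      using pos[OF \<phi>(1)] by (simp add: c_zero)
  qed
  then obtain s t where st: "s \<in> T" "t \<in> T" "f * s = 1 + t"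
    by blast
  obtain N where N: "N > 0" "c N - s \<in> T"
    using archimedean_gt by blast
  have descend: "f + c (r - 1 / N) \<in> T" if "f + c r \<in> T" "0 \<le> r" for r
  proof -
    have "c (1 / N) * ((c N - s) * (f + c r) + (t + c r * s)) \<in> T"
      by (intro mult_mem add_mem that N st const_mem) (use N in simp)
    also have "(c N - s) * (f + c r) + (t + c r * s) = c N * (f + c r) - 1"
      using st(3) by (simp add: algebra_simps)
    also have "c (1 / N) * (c N * (f + c r) - 1) = (c (1 / N) * c N) * (f + c r) - c (1 / N)"
      by (simp add: algebra_simps)
    also have "c (1 / N) * c N = 1"
      using N by (simp add: c_one flip: c_mult)
    finally show ?thesis
      by (simp add: c_diff algebra_simps)
  qed
  obtain R where R: "c R + f \<in> T"
    using archimedean[of "- f"] by auto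
  \<comment> \<open>starting at a multiple of \<open>1 / N\<close> makes the descent end at \<open>0\<close> exactly\<close>
  have "f + c (real n / N) \<in> T \<Longrightarrow> f \<in> T" for n
  proof (induction n)
    case (Suc n)
    have "f + c (real (Suc n) / N - 1 / N) \<in> T"
      by (rule descend) (use Suc.prems N in auto)
    then show ?case
      using Suc.IH by (simp add: diff_divide_distrib[symmetric])
  qed (simp add: c_zero)
  moreover obtain n where "R \<le> real n / N"
    using real_arch_simple[of "R * N"] N by (auto simp: field_simps)
  then have "(c R + f) + c (real n / N - R) \<in> T"
    by (intro add_mem R const_mem) simp
  then have "f + c (real n / N) \<in> T"
    by (simp add: c_diff algebra_simps)
  ultimately show ?thesis
    by blast
qed

end

section \<open>Real characters of the polynomial ring\<close>

lemma pconst_add: "pconst (r + s) = pconst r + pconst s"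
  by (simp add: pconst_def single_add)

lemma pconst_mult: "pconst (r * s) = pconst r * pconst s"
  by (simp add: pconst_def mult_single)

lemma pconst_0: "pconst 0 = 0" and pconst_1: "pconst 1 = 1"
  by (simp_all add: pconst_def)

lemma pconst_minus: "pconst (- r) = - pconst r"
  by (simp add: pconst_def single_uminus)

lemma pconst_diff: "pconst (r - s) = pconst r - pconst s"
  by (simp add: pconst_def single_diff)

lemma pconst_sum: "pconst (sum g A) = (\<Sum>i\<in>A. pconst (g i))"
  by (induction A rule: infinite_finite_induct) (simp_all add: pconst_0 pconst_add)

lemma rpoly_eq_sum_monomials:
  fixes p :: "'n rpoly"
  shows "p = (\<Sum>m\<in>Poly_Mapping.keys p. Poly_Mapping.single m (Poly_Mapping.lookup p m))"
  by (rule poly_mapping_eqI)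
     (auto simp: lookup_sum lookup_single when_def sum.delta' in_keys_iff)

lemma monomial_eq_prod_pvar:
  fixes m :: "'n::finite \<Rightarrow>\<^sub>0 nat"
  shows "Poly_Mapping.single m (1::real) = (\<Prod>i\<in>UNIV. pvar i ^ Poly_Mapping.lookup m i)"
proof -
  have power: "pvar i ^ k = Poly_Mapping.single (Poly_Mapping.single i k) (1::real)" for i :: 'n and k
    by (induction k) (simp_all add: pvar_def mult_single flip: single_add)
  have prod: "(\<Prod>i\<in>A. Poly_Mapping.single (e i) (1::real)) = Poly_Mapping.single (\<Sum>i\<in>A. e i) 1"
    for A :: "'n set" and e :: "'n \<Rightarrow> 'n \<Rightarrow>\<^sub>0 nat"
    by (induction A rule: infinite_finite_induct) (simp_all add: mult_single)
  have "(\<Sum>i\<in>UNIV. Poly_Mapping.single i (Poly_Mapping.lookup m i)) = m"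
    by (rule poly_mapping_eqI) (auto simp: lookup_sum lookup_single when_def sum.delta')
  then show ?thesis
    by (simp add: power prod)
qed

lemma ring_hom_eq_peval:
  fixes \<phi> :: "'n::finite rpoly \<Rightarrow> real"
  assumes add: "\<And>a b. \<phi> (a + b) = \<phi> a + \<phi> b" and mult: "\<And>a b. \<phi> (a * b) = \<phi> a * \<phi> b"
    and const: "\<And>r. \<phi> (pconst r) = r"
  shows "\<phi> p = peval p (vec_lambda (\<lambda>i. \<phi> (pvar i)))"
proof -
  have zero: "\<phi> 0 = 0" and one: "\<phi> 1 = 1"
    using const[of 0] const[of 1] by (simp_all add: pconst_0 pconst_1)
  have sum: "\<phi> (sum g A) = (\<Sum>x\<in>A. \<phi> (g x))" for g :: "('n \<Rightarrow>\<^sub>0 nat) \<Rightarrow> 'n rpoly" and A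
    by (induction A rule: infinite_finite_induct) (simp_all add: zero add)
  have prod: "\<phi> (prod g A) = (\<Prod>x\<in>A. \<phi> (g x))" for g :: "'n \<Rightarrow> 'n rpoly" and A
    by (induction A rule: infinite_finite_induct) (simp_all add: one mult)
  have power: "\<phi> (a ^ k) = \<phi> a ^ k" for a k
    by (induction k) (simp_all add: one mult)
  have single: "Poly_Mapping.single m r = pconst r * Poly_Mapping.single m 1"
    for m :: "'n \<Rightarrow>\<^sub>0 nat" and r
    by (simp add: pconst_def mult_single)
  have "\<phi> p = \<phi> (\<Sum>m\<in>Poly_Mapping.keys p. Poly_Mapping.single m (Poly_Mapping.lookup p m))"
    by (subst (1) rpoly_eq_sum_monomials) (rule refl)
  also have "\<dots> = (\<Sum>m\<in>Poly_Mapping.keys p. \<phi> (Poly_Mapping.single m (Poly_Mapping.lookup p m)))"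
    by (rule sum)
  also have "\<dots> = peval p (vec_lambda (\<lambda>i. \<phi> (pvar i)))"
    unfolding peval_def
    by (intro sum.cong refl) (subst single, simp add: mult const monomial_eq_prod_pvar prod power)
  finally show ?thesis .
qed

section \<open>Quadratic forms of Kronecker powers\<close>

text \<open>Index \<open>a * n + b\<close> of a Kronecker product stands for the pair \<open>(a, b)\<close>.\<close>

lemma sum_div_mod:
  fixes g :: "nat \<Rightarrow> nat \<Rightarrow> 'a::comm_monoid_add"
  shows "(\<Sum>i<m * n. g (i div n) (i mod n)) = (\<Sum>a<m. \<Sum>b<n. g a b)"
proof -
  have bound: "a * n + b < m * n" if "a < m" "b < n" for a b
  proof -
    have "a * n + b < (a + 1) * n"
      using that by simp
    also have "\<dots> \<le> m * n"
      by (rule mult_le_mono1) (use that in simp)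
    finally show ?thesis .
  qed
  have "(\<Sum>i<m * n. g (i div n) (i mod n)) = (\<Sum>(a, b)\<in>{..<m} \<times> {..<n}. g a b)"
    by (rule sum.reindex_bij_witness[of _ "\<lambda>(a, b). a * n + b" "\<lambda>i. (i div n, i mod n)"])
       (auto simp: bound less_mult_imp_div_less intro!: mod_less_divisor Nat.gr0I)
  then show ?thesis
    by (simp add: sum.cartesian_product)
qed

lemma kron_pow_carrier:
  "U \<in> carrier_mat N N \<Longrightarrow> kron_pow U k \<in> carrier_mat (N ^ k) (N ^ k)"
  by (induction k) (auto simp: kron_def)

lemma kron_index:
  assumes "A \<in> carrier_mat m m" "B \<in> carrier_mat n n" "i < m * n" "j < m * n"
  shows "kron A B $$ (i, j) = A $$ (i div n, j div n) * B $$ (i mod n, j mod n)"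
  using assms by (auto simp: kron_def)

lemma kron_pow_1_index:
  assumes "U \<in> carrier_mat N N" "i < N" "j < N"
  shows "kron_pow U 1 $$ (i, j) = U $$ (i, j)"
  using kron_index[OF assms(1) one_carrier_mat[of 1], of i j] assms by simp

text \<open>Associativity of the Kronecker product: \<open>U\<^bsup>\<otimes>(j+k)\<^esup> = U\<^bsup>\<otimes>j\<^esup> \<otimes> U\<^bsup>\<otimes>k\<^esup>\<close>. For the
  indices this is the uniqueness of the digits of a number written in base \<open>N\<close>.\<close>

lemma kron_pow_add_index:
  assumes U: "U \<in> carrier_mat N N" and "i < N ^ (j + k)" "i' < N ^ (j + k)"
  shows "kron_pow U (j + k) $$ (i, i') =
    kron_pow U j $$ (i div N ^ k, i' div N ^ k) * kron_pow U k $$ (i mod N ^ k, i' mod N ^ k)"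
  using assms(2,3)
proof (induction j arbitrary: i i')
  case 0
  then show ?case by simp
next
  case (Suc j)
  have pos: "N ^ (j + k) > 0"
    using Suc.prems(1) by (intro Nat.gr0I) auto
  have d: "x div N ^ k < N ^ Suc j" if "x < N ^ (Suc j + k)" for x
    by (rule less_mult_imp_div_less) (use that in \<open>simp add: power_add mult.assoc\<close>)
  have "kron_pow U (Suc j + k) $$ (i, i') = U $$ (i div N ^ (j + k), i' div N ^ (j + k)) *
      kron_pow U (j + k) $$ (i mod N ^ (j + k), i' mod N ^ (j + k))"
    using kron_index[OF U kron_pow_carrier[OF U, of "j + k"], of i i'] Suc.prems by simp
  also have "\<dots> = U $$ (i div N ^ (j + k), i' div N ^ (j + k)) *
      (kron_pow U j $$ (i mod N ^ (j + k) div N ^ k, i' mod N ^ (j + k) div N ^ k) *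
       kron_pow U k $$ (i mod N ^ (j + k) mod N ^ k, i' mod N ^ (j + k) mod N ^ k))"
    by (subst Suc.IH) (use pos in auto)
  also have "\<dots> = U $$ (i div N ^ k div N ^ j, i' div N ^ k div N ^ j) *
      kron_pow U j $$ (i div N ^ k mod N ^ j, i' div N ^ k mod N ^ j) *
       kron_pow U k $$ (i mod N ^ k, i' mod N ^ k)"
  proof -
    have 1: "x div N ^ (j + k) = x div N ^ k div N ^ j" for x
      by (metis add.commute div_mult2_eq power_add)
    have 2: "x mod N ^ (j + k) div N ^ k = x div N ^ k mod N ^ j" for x
      using pos by (simp add: power_add mod_mult2_eq mult.commute[of "N ^ j"])
    have 3: "x mod N ^ (j + k) mod N ^ k = x mod N ^ k" for x
      by (simp add: power_add mod_mod_cancel)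
    show ?thesis
      unfolding 1 2 3 by (simp only: mult.assoc)
  qed
  also have "U $$ (i div N ^ k div N ^ j, i' div N ^ k div N ^ j) *
      kron_pow U j $$ (i div N ^ k mod N ^ j, i' div N ^ k mod N ^ j) =
      kron_pow U (Suc j) $$ (i div N ^ k, i' div N ^ k)"
    using kron_index[OF U kron_pow_carrier[OF U, of j], of "i div N ^ k" "i' div N ^ k"]
      d[OF Suc.prems(1)] d[OF Suc.prems(2)] by simp
  finally show ?case .
qed

lemma trace_kron_pow:
  assumes U: "U \<in> carrier_mat N N"
  shows "(\<Sum>i<N ^ k. kron_pow U k $$ (i, i)) = (\<Sum>i<N. U $$ (i, i)) ^ k"
proof (induction k)
  case (Suc k)
  have "(\<Sum>i<N ^ Suc k. kron_pow U (Suc k) $$ (i, i)) =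
      (\<Sum>i<N * N ^ k. U $$ (i div N ^ k, i div N ^ k) * kron_pow U k $$ (i mod N ^ k, i mod N ^ k))"
    by (intro sum.cong) (simp_all add: kron_index[OF U kron_pow_carrier[OF U, of k]])
  also have "\<dots> = (\<Sum>a<N. \<Sum>b<N ^ k. U $$ (a, a) * kron_pow U k $$ (b, b))"
    by (rule sum_div_mod)
  also have "\<dots> = (\<Sum>i<N. U $$ (i, i)) ^ Suc k"
    by (simp add: Suc.IH sum_product flip: Suc.IH)
  finally show ?case .
qed simp

text \<open>The quadratic form \<open>v\<^sup>T U\<^bsup>\<otimes>k\<^esup> v\<close>; only the first \<open>(dim_row U) ^ k\<close> values of \<open>v\<close> matter. Taking \<open>v\<close> to be a
  function avoids dimension side conditions when vectors are combined.\<close>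

definition kron_form :: "'n rpoly mat \<Rightarrow> nat \<Rightarrow> (nat \<Rightarrow> real) \<Rightarrow> 'n rpoly" where
  "kron_form U k v = (\<Sum>i<dim_row U ^ k. \<Sum>j<dim_row U ^ k.
     pconst (v i * v j) * kron_pow U k $$ (i, j))"

text \<open>The mixed-product rule; the coefficient vector on the right is \<open>v \<otimes> w\<close>.\<close>

lemma kron_form_mult:
  assumes U: "U \<in> carrier_mat N N"
  shows "kron_form U j v * kron_form U k w =
    kron_form U (j + k) (\<lambda>i. v (i div N ^ k) * w (i mod N ^ k))"
proof -
  have N: "dim_row U = N"
    using U by simp
  define F where "F a b a' b' = (pconst (v a * v a') * kron_pow U j $$ (a, a')) *
      (pconst (w b * w b') * kron_pow U k $$ (b, b'))" for a b a' b'
  have "kron_form U (j + k) (\<lambda>i. v (i div N ^ k) * w (i mod N ^ k)) =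
      (\<Sum>i<N ^ j * N ^ k. \<Sum>i'<N ^ j * N ^ k. F (i div N ^ k) (i mod N ^ k) (i' div N ^ k) (i' mod N ^ k))"
    unfolding kron_form_def N power_add[symmetric]
    by (intro sum.cong refl) (simp add: kron_pow_add_index[OF U] F_def pconst_mult mult_ac)
  also have "\<dots> = (\<Sum>i<N ^ j * N ^ k. \<Sum>a'<N ^ j. \<Sum>b'<N ^ k. F (i div N ^ k) (i mod N ^ k) a' b')"
    by (intro sum.cong refl sum_div_mod)
  also have "\<dots> = (\<Sum>a<N ^ j. \<Sum>b<N ^ k. \<Sum>a'<N ^ j. \<Sum>b'<N ^ k. F a b a' b')"
    by (rule sum_div_mod)
  also have "\<dots> = kron_form U j v * kron_form U k w"
    unfolding kron_form_def N F_def by (simp only: sum_product)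
  finally show ?thesis
    by simp
qed

text \<open>Vectors supported on at most two indices are all that Lagrange's identity and polarization use.\<close>

lemma kron_form_two_entries:
  assumes "i < dim_row U ^ k" "j < dim_row U ^ k"
  shows "kron_form U k (\<lambda>a. r * of_bool (a = i) + s * of_bool (a = j)) =
    pconst (r * r) * kron_pow U k $$ (i, i) +
    pconst (r * s) * (kron_pow U k $$ (i, j) + kron_pow U k $$ (j, i)) +
    pconst (s * s) * kron_pow U k $$ (j, j)"
proof -
  define v where "v a = r * of_bool (a = i) + s * of_bool (a = j)" for a
  have select: "(\<Sum>a<dim_row U ^ k. pconst (v a) * g a) = pconst r * g i + pconst s * g j" for g
  proof -
    have "pconst (v a) * g a = (if a = i then pconst r * g a else 0) + (if a = j then pconst s * g a else 0)" for a
      by (simp add: v_def pconst_add pconst_0 distrib_right)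
    then show ?thesis
      using assms by (simp add: sum.distrib)
  qed
  have "kron_form U k v =
      (\<Sum>a<dim_row U ^ k. pconst (v a) * (\<Sum>b<dim_row U ^ k. pconst (v b) * kron_pow U k $$ (a, b)))"
    by (simp add: kron_form_def pconst_mult sum_distrib_left mult.assoc)
  also have "\<dots> = pconst (r * r) * kron_pow U k $$ (i, i) +
    pconst (r * s) * (kron_pow U k $$ (i, j) + kron_pow U k $$ (j, i)) +
    pconst (s * s) * kron_pow U k $$ (j, j)"
    unfolding select by (simp add: pconst_mult algebra_simps)
  finally show ?thesis
    unfolding v_def .
qed

text \<open>The sums from \<open>HG\<close> in which every coefficient matrix is given as a sum of rank-one squares. With this
  presentation the product of two members is a member without a spectral decomposition of the
  coefficient matrices.\<close>

inductive_set kron_cone :: "'n rpoly mat \<Rightarrow> 'n rpoly set" for U where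
  zero: "0 \<in> kron_cone U"
| step: "p \<in> kron_cone U \<Longrightarrow> kron_form U k v + p \<in> kron_cone U"

lemma kron_form_mem: "kron_form U k v \<in> kron_cone U"
  using kron_cone.step[OF kron_cone.zero] by simp

lemma kron_cone_add: "p \<in> kron_cone U \<Longrightarrow> p' \<in> kron_cone U \<Longrightarrow> p + p' \<in> kron_cone U"
  by (induction rule: kron_cone.induct) (simp_all add: add.assoc kron_cone.step)

lemma kron_cone_sum: "(\<And>i. i \<in> A \<Longrightarrow> g i \<in> kron_cone U) \<Longrightarrow> sum g A \<in> kron_cone U"
  by (induction A rule: infinite_finite_induct) (simp_all add: kron_cone.zero kron_cone_add)

lemma kron_cone_mult:
  assumes U: "U \<in> carrier_mat N N" and "p \<in> kron_cone U" and p': "p' \<in> kron_cone U"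
  shows "p * p' \<in> kron_cone U"
  using assms(2)
proof induction
  case (step p k v)
  from p' have "kron_form U k v * p' \<in> kron_cone U"
  proof induction
    case (step p' l w)
    then show ?case
      by (simp add: distrib_left kron_form_mult[OF U] kron_cone.step)
  qed (simp add: kron_cone.zero)
  with step.IH show ?case
    by (simp add: distrib_right kron_cone_add)
qed (simp add: kron_cone.zero)

lemma pconst_mem_kron_cone: "0 \<le> r \<Longrightarrow> pconst r \<in> kron_cone U"
  using kron_form_mem[of U 0 "\<lambda>_. sqrt r"] by (simp add: kron_form_def)

text \<open>Lagrange's identity: with \<open>w i j = v i e\<^sub>j - v j e\<^sub>i\<close>, half the sum of all \<open>(w i j) (w i j)\<^sup>T\<close> is
  \<open>\<bar>v\<bar>\<^sup>2 I - v v\<^sup>T\<close>. Pairing it with \<open>U\<^bsup>\<otimes>k\<^esup>\<close> turns the identity matrix into the trace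
  \<open>\<tau>\<^sup>k\<close>, a constant.\<close>

lemma norm_bound_kron_form:
  assumes U: "U \<in> carrier_mat N N" and trace: "(\<Sum>i<N. U $$ (i, i)) = pconst \<tau>"
  shows "pconst ((\<Sum>i<N ^ k. v i ^ 2) * \<tau> ^ k) - kron_form U k v \<in> kron_cone U"
proof -
  have N: "dim_row U = N"
    using U by simp
  define E where "E i j = kron_pow U k $$ (i, j)" for i j
  define w where "w i j a = v i * of_bool (a = j) + (- v j) * of_bool (a = i)" for i j a :: nat
  have pconst_power: "pconst (r ^ l) = pconst r ^ l" for r and l :: nat
    by (induction l) (simp_all add: pconst_1 pconst_mult)
  have "(\<Sum>i<N ^ k. \<Sum>j<N ^ k. kron_form U k (w i j)) =
      (\<Sum>i<N ^ k. \<Sum>j<N ^ k. pconst (v i ^ 2) * E j j - pconst (v i * v j) * E i j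
        - pconst (v j * v i) * E j i + pconst (v j ^ 2) * E i i)"
    unfolding w_def E_def
    by (intro sum.cong refl, subst kron_form_two_entries)
       (auto simp: N pconst_minus power2_eq_square algebra_simps)
  also have "\<dots> = (\<Sum>i<N ^ k. \<Sum>j<N ^ k. pconst (v i ^ 2) * E j j) - kron_form U k v
        - (\<Sum>i<N ^ k. \<Sum>j<N ^ k. pconst (v j * v i) * E j i)
        + (\<Sum>i<N ^ k. \<Sum>j<N ^ k. pconst (v j ^ 2) * E i i)"
    by (simp add: sum.distrib sum_subtractf kron_form_def N E_def)
  also have "(\<Sum>i<N ^ k. \<Sum>j<N ^ k. pconst (v j * v i) * E j i) = kron_form U k v"
    unfolding kron_form_def N E_def by (rule sum.swap)
  also have "(\<Sum>i<N ^ k. \<Sum>j<N ^ k. pconst (v j ^ 2) * E i i) =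
      (\<Sum>i<N ^ k. \<Sum>j<N ^ k. pconst (v i ^ 2) * E j j)"
    by (rule sum.swap)
  also have "(\<Sum>i<N ^ k. \<Sum>j<N ^ k. pconst (v i ^ 2) * E j j) =
      pconst ((\<Sum>i<N ^ k. v i ^ 2) * \<tau> ^ k)"
    unfolding pconst_mult pconst_sum pconst_power trace[symmetric] trace_kron_pow[OF U, symmetric] E_def
    by (simp add: sum_product)
  finally have eq: "(\<Sum>i<N ^ k. \<Sum>j<N ^ k. kron_form U k (w i j)) =
      pconst ((\<Sum>i<N ^ k. v i ^ 2) * \<tau> ^ k) - kron_form U k v - kron_form U k v
      + pconst ((\<Sum>i<N ^ k. v i ^ 2) * \<tau> ^ k)" .
  have "pconst (1 / 2) * (\<Sum>i<N ^ k. \<Sum>j<N ^ k. kron_form U k (w i j)) \<in> kron_cone U"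
    by (intro kron_cone_mult[OF U] pconst_mem_kron_cone kron_cone_sum kron_form_mem) simp
  moreover have half: "pconst (1 / 2) * (a - b - b + a) = a - b" for a b :: "'a rpoly"
  proof -
    have "pconst (1 / 2) * (a - b - b + a) = (pconst (1 / 2) + pconst (1 / 2)) * (a - b)"
      by (simp add: algebra_simps)
    then show ?thesis
      by (simp add: pconst_1 flip: pconst_add)
  qed
  ultimately show ?thesis
    unfolding eq half by simp
qed

text \<open>Bounds from both sides are required so that the set is a linear subspace; a one-sided bound would
  not survive negation, and polarization involves signs.\<close>

definition kron_bounded :: "'n rpoly mat \<Rightarrow> 'n rpoly set" where
  "kron_bounded U = {p. \<exists>r. pconst r - p \<in> kron_cone U \<and> pconst r + p \<in> kron_cone U}"

lemma kron_bounded_add: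
  assumes "p \<in> kron_bounded U" "p' \<in> kron_bounded U"
  shows "p + p' \<in> kron_bounded U"
proof -
  obtain r r' where "pconst r - p \<in> kron_cone U" "pconst r + p \<in> kron_cone U"
    "pconst r' - p' \<in> kron_cone U" "pconst r' + p' \<in> kron_cone U"
    using assms unfolding kron_bounded_def by auto
  then have "(pconst r - p) + (pconst r' - p') \<in> kron_cone U"
    "(pconst r + p) + (pconst r' + p') \<in> kron_cone U"
    by (simp_all add: kron_cone_add)
  then show ?thesis
    unfolding kron_bounded_def by (auto intro!: exI[of _ "r + r'"] simp: pconst_add algebra_simps)
qed

lemma kron_bounded_minus: "p \<in> kron_bounded U \<Longrightarrow> - p \<in> kron_bounded U"
  unfolding kron_bounded_def by auto

lemma kron_bounded_diff: "p \<in> kron_bounded U \<Longrightarrow> p' \<in> kron_bounded U \<Longrightarrow> p - p' \<in> kron_bounded U"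
  using kron_bounded_add[OF _ kron_bounded_minus, of p U p'] by simp

lemma kron_bounded_pconst: "pconst r \<in> kron_bounded U"
  unfolding kron_bounded_def
  by (auto intro!: exI[of _ "\<bar>r\<bar>"] pconst_mem_kron_cone simp flip: pconst_add pconst_diff)

lemma kron_bounded_sum: "(\<And>i. i \<in> A \<Longrightarrow> g i \<in> kron_bounded U) \<Longrightarrow> sum g A \<in> kron_bounded U"
  by (induction A rule: infinite_finite_induct)
     (simp_all add: kron_bounded_add kron_bounded_pconst[of 0, unfolded pconst_0])

lemma kron_bounded_scale:
  assumes U: "U \<in> carrier_mat N N" and p: "p \<in> kron_bounded U"
  shows "pconst r * p \<in> kron_bounded U"
proof -
  have nonneg: "pconst s * p \<in> kron_bounded U" if "0 \<le> s" for s
  proof -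
    obtain r where "pconst r - p \<in> kron_cone U" "pconst r + p \<in> kron_cone U"
      using p unfolding kron_bounded_def by auto
    then have "pconst s * (pconst r - p) \<in> kron_cone U" "pconst s * (pconst r + p) \<in> kron_cone U"
      using kron_cone_mult[OF U pconst_mem_kron_cone[OF that]] by blast+
    then show ?thesis
      unfolding kron_bounded_def
      by (auto intro!: exI[of _ "s * r"] simp: pconst_mult algebra_simps)
  qed
  show ?thesis
  proof (cases "0 \<le> r")
    case False
    then have "- (pconst (- r) * p) \<in> kron_bounded U"
      by (intro kron_bounded_minus nonneg) simp
    then show ?thesis
      by (simp add: pconst_minus)
  qed (rule nonneg)
qed

lemma kron_bounded_kron_form:
  assumes U: "U \<in> carrier_mat N N" and trace: "(\<Sum>i<N. U $$ (i, i)) = pconst \<tau>"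
  shows "kron_form U k v \<in> kron_bounded U"
proof -
  let ?r = "(\<Sum>i<N ^ k. v i ^ 2) * \<tau> ^ k"
  have "pconst \<bar>?r\<bar> - kron_form U k v \<in> kron_cone U"
    using kron_cone_add[OF norm_bound_kron_form[OF U trace, of v k] pconst_mem_kron_cone[of "\<bar>?r\<bar> - ?r"]]
    by (simp add: pconst_diff)
  moreover have "pconst \<bar>?r\<bar> + kron_form U k v \<in> kron_cone U"
    by (intro kron_cone_add kron_form_mem pconst_mem_kron_cone) simp
  ultimately show ?thesis
    unfolding kron_bounded_def by blast
qed

lemma frob_pconst_eq_sum:
  assumes "A \<in> carrier_mat n n" "B \<in> carrier_mat n n"
  shows "frob (map_mat pconst A) B = (\<Sum>i<n. \<Sum>j<n. pconst (A $$ (i, j)) * B $$ (i, j))"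
proof -
  have "frob (map_mat pconst A) B = (\<Sum>j<n. \<Sum>i<n. pconst (A $$ (i, j)) * B $$ (i, j))"
    using assms by (simp add: frob_def scalar_prod_def lessThan_atLeast0)
  also have "\<dots> = (\<Sum>i<n. \<Sum>j<n. pconst (A $$ (i, j)) * B $$ (i, j))"
    by (rule sum.swap)
  finally show ?thesis .
qed

text \<open>Polarization: with \<open>E = U\<^bsup>\<otimes>k\<^esup>\<close>, the sum \<open>E i j + E j i\<close> is the form of \<open>e\<^sub>i + e\<^sub>j\<close> minus the forms of
  \<open>e\<^sub>i\<close> and \<open>e\<^sub>j\<close>. As \<open>L\<close> is symmetric, pairing with \<open>L\<close> only involves these symmetrized entries.\<close>

lemma kron_bounded_frob:
  assumes U: "U \<in> carrier_mat N N" and trace: "(\<Sum>i<N. U $$ (i, i)) = pconst \<tau>"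
    and L: "L \<in> carrier_mat (N ^ k) (N ^ k)" "transpose_mat L = L"
  shows "frob (map_mat pconst L) (kron_pow U k) \<in> kron_bounded U"
proof -
  have N: "dim_row U = N"
    using U by simp
  define E where "E i j = kron_pow U k $$ (i, j)" for i j
  have polar: "E i j + E j i \<in> kron_bounded U" if "i < N ^ k" "j < N ^ k" for i j
  proof -
    have entry: "E i i \<in> kron_bounded U" if "i < N ^ k" for i
      using kron_bounded_kron_form[OF U trace, of k "\<lambda>a. 1 * of_bool (a = i) + 0 * of_bool (a = i)"]
        kron_form_two_entries[of i U k i 1 0] that
      by (simp add: N pconst_0 pconst_1 E_def)
    have "kron_form U k (\<lambda>a. 1 * of_bool (a = i) + 1 * of_bool (a = j)) = E i i + (E i j + E j i) + E j j"
      using that unfolding E_def by (subst kron_form_two_entries) (simp_all add: N pconst_1)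
    then have "E i j + E j i = kron_form U k (\<lambda>a. 1 * of_bool (a = i) + 1 * of_bool (a = j)) - E i i - E j j"
      by simp
    then show ?thesis
      using that by (simp only:) (intro kron_bounded_diff entry kron_bounded_kron_form[OF U trace])
  qed
  have sym: "L $$ (j, i) = L $$ (i, j)" if "i < N ^ k" "j < N ^ k" for i j
    using L that by (metis carrier_matD index_transpose_mat(1))
  let ?S = "\<Sum>i<N ^ k. \<Sum>j<N ^ k. pconst (L $$ (i, j)) * E i j"
  \<comment> \<open>symmetrize: \<open>?S\<close> is the average of itself and its transposed version\<close>
  have swap: "?S = (\<Sum>i<N ^ k. \<Sum>j<N ^ k. pconst (L $$ (i, j)) * E j i)"
    by (subst sum.swap) (intro sum.cong refl, simp add: sym)
  have "?S = (pconst (1 / 2) + pconst (1 / 2)) * ?S"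
    by (simp add: pconst_1 flip: pconst_add)
  also have "\<dots> = pconst (1 / 2) * (?S + ?S)"
    by (simp add: algebra_simps)
  also have "?S + ?S = ?S + (\<Sum>i<N ^ k. \<Sum>j<N ^ k. pconst (L $$ (i, j)) * E j i)"
    by (simp only: swap)
  also have "\<dots> = (\<Sum>i<N ^ k. \<Sum>j<N ^ k. pconst (L $$ (i, j)) * (E i j + E j i))"
    by (simp add: sum.distrib distrib_left)
  also have "pconst (1 / 2) * \<dots> \<in> kron_bounded U"
    by (intro kron_bounded_scale[OF U] kron_bounded_sum polar) auto
  finally show ?thesis
    unfolding frob_pconst_eq_sum[OF L(1) kron_pow_carrier[OF U]] E_def .
qed

section \<open>The cone inside the set of matrix certificates\<close>

lemma Gtilde_carrier:
  "G \<in> carrier_mat q q \<Longrightarrow> Gtilde G \<in> carrier_mat (2 * q) (2 * q)"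
  by (auto simp: Gtilde_def Let_def)

lemma Gtilde_upper_left:
  assumes "G \<in> carrier_mat q q" "i < q" "j < q"
  shows "Gtilde G $$ (i, j) = G $$ (i, j)"
  using assms by (simp add: Gtilde_def Let_def)

text \<open>The reason for adjoining the block \<open>1 - G\<close>: it makes the trace constant.\<close>

lemma trace_Gtilde:
  assumes G: "G \<in> carrier_mat q q"
  shows "(\<Sum>i<2 * q. Gtilde G $$ (i, i)) = pconst (real q)"
proof -
  have "(\<Sum>i<2 * q. Gtilde G $$ (i, i)) =
      (\<Sum>i<q. Gtilde G $$ (i, i)) + (\<Sum>i<q. Gtilde G $$ (q + i, q + i))"
    using sum.nat_group[of "\<lambda>i. Gtilde G $$ (i, i)" q 2]
    by (simp add: numeral_2_eq_2 sum.atLeastLessThan_shift_0[of _ q] lessThan_atLeast0 add.commute)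
  also have "\<dots> = (\<Sum>i<q. G $$ (i, i)) + (\<Sum>i<q. 1 - G $$ (i, i))"
    using G by (intro arg_cong2[of _ _ _ _ "(+)"] sum.cong) (auto simp: Gtilde_def Let_def)
  also have "\<dots> = (\<Sum>i<q. pconst 1)"
    by (simp add: sum_subtractf pconst_1)
  also have "\<dots> = pconst (real q)"
    unfolding pconst_sum[symmetric] by simp
  finally show ?thesis .
qed

lemma rank_one_psd: "mat n n (\<lambda>(i, j). v i * v j) \<in> psd_mats n"
proof -
  have "0 \<le> scalar_prod x (mat n n (\<lambda>(i, j). v i * v j) *\<^sub>v x)" if "x \<in> carrier_vec n" for x
  proof -
    have "scalar_prod x (mat n n (\<lambda>(i, j). v i * v j) *\<^sub>v x) =
        (\<Sum>i<n. vec_index x i * (\<Sum>j<n. v i * v j * vec_index x j))"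
      using that by (simp add: scalar_prod_def lessThan_atLeast0)
    also have "\<dots> = (\<Sum>i<n. vec_index x i * v i) * (\<Sum>j<n. vec_index x j * v j)"
      unfolding sum_product by (simp add: sum_distrib_left mult_ac)
    finally show ?thesis
      by simp
  qed
  then show ?thesis
    by (auto simp: psd_mats_def mult.commute)
qed

lemma zero_psd: "0\<^sub>m n n \<in> psd_mats n"
proof -
  have "mat n n (\<lambda>(i, j). 0 * 0) = (0\<^sub>m n n :: real mat)"
    by (rule eq_matI) auto
  then show ?thesis
    using rank_one_psd[of n "\<lambda>_. 0"] by simp
qed

lemma psd_add:
  assumes "A \<in> psd_mats n" "B \<in> psd_mats n"
  shows "A + B \<in> psd_mats n"
  using assms
  by (auto simp: psd_mats_def transpose_add add_mult_distrib_mat_vec[of _ n n]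
      scalar_prod_add_distrib[of _ n] intro!: add_nonneg_nonneg)

lemma frob_add:
  assumes "A \<in> carrier_mat n n" "B \<in> carrier_mat n n" "C \<in> carrier_mat n n"
  shows "frob (map_mat pconst (A + B)) C = frob (map_mat pconst A) C + frob (map_mat pconst B) C"
  using assms by (simp add: frob_pconst_eq_sum[of _ n] pconst_add distrib_right sum.distrib)

lemma frob_zero: "C \<in> carrier_mat n n \<Longrightarrow> frob (map_mat pconst (0\<^sub>m n n)) C = 0"
  by (simp add: frob_pconst_eq_sum[of _ n] pconst_0)

lemma kron_form_eq_frob:
  assumes U: "U \<in> carrier_mat N N"
  shows "kron_form U k v = frob (map_mat pconst (mat (N ^ k) (N ^ k) (\<lambda>(i, j). v i * v j))) (kron_pow U k)"
  using U by (subst frob_pconst_eq_sum[OF _ kron_pow_carrier[OF U]]) (auto simp: kron_form_def)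

text \<open>For \<open>k = 0\<close> the form is a nonnegative constant and is absorbed by the constant term. Otherwise
  \<open>v v\<^sup>T\<close> is added to the coefficient matrix of index \<open>k\<close>, after padding the coefficients with zero
  matrices in case \<open>k\<close> exceeds the length of the given sum.\<close>

lemma kron_form_add_mem_HG:
  assumes G: "G \<in> carrier_mat q q" and p: "p \<in> HG G"
  shows "kron_form (Gtilde G) k v + p \<in> HG G"
proof -
  note U = Gtilde_carrier[OF G]
  have q: "dim_row G = q"
    using G by simp
  obtain l m L where p_eq: "p = pconst l + (\<Sum>i=1..m. frob (map_mat pconst (L i)) (kron_pow (Gtilde G) i))"
    and l: "0 \<le> l" and L: "\<And>i. i \<in> {1..m} \<Longrightarrow> L i \<in> psd_mats ((2 * q) ^ i)"
    using p unfolding HG_def q by auto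
  show ?thesis
  proof (cases "k = 0")
    case True
    have "kron_form (Gtilde G) k v + p = pconst (v 0 * v 0 + l) +
        (\<Sum>i=1..m. frob (map_mat pconst (L i)) (kron_pow (Gtilde G) i))"
      by (simp add: True kron_form_def p_eq pconst_add)
    moreover have "0 \<le> v 0 * v 0 + l"
      using l by simp
    ultimately show ?thesis
      unfolding HG_def q using L by blast
  next
    case False
    define Z where "Z i = (0\<^sub>m ((2 * q) ^ i) ((2 * q) ^ i) :: real mat)" for i
    define L1 where "L1 i = (if i \<le> m then L i else Z i)" for i
    define L2 where "L2 i = (if i = k then mat ((2 * q) ^ i) ((2 * q) ^ i) (\<lambda>(a, b). v a * v b)
      else Z i)" for i
    define F where "F M i = frob (map_mat pconst (M i)) (kron_pow (Gtilde G) i)" for M i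
    have psd: "L1 i \<in> psd_mats ((2 * q) ^ i)" "L2 i \<in> psd_mats ((2 * q) ^ i)" if "i \<ge> 1" for i
      using that L[of i] unfolding L1_def L2_def Z_def
      by (simp_all only: zero_psd rank_one_psd atLeastAtMost_iff split: if_splits) simp_all
    have Z: "frob (map_mat pconst (Z i)) (kron_pow (Gtilde G) i) = 0" for i
      unfolding Z_def by (rule frob_zero[OF kron_pow_carrier[OF U]])
    have F1: "(\<Sum>i=1..max m k. F L1 i) = (\<Sum>i=1..m. F L i)"
    proof -
      have "(\<Sum>i=1..max m k. F L1 i) = (\<Sum>i=1..m. F L1 i)"
        by (rule sum.mono_neutral_right)
           (auto simp: F_def L1_def Z)
      then show ?thesis
        by (simp add: F_def L1_def)
    qed
    have F2: "(\<Sum>i=1..max m k. F L2 i) = kron_form (Gtilde G) k v"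
    proof -
      have "(\<Sum>i=1..max m k. F L2 i) = (\<Sum>i\<in>{k}. F L2 i)"
        by (rule sum.mono_neutral_right)
           (use False in \<open>auto simp: F_def L2_def Z\<close>)
      then show ?thesis
        by (simp add: F_def L2_def kron_form_eq_frob[OF U])
    qed
    have "F (\<lambda>i. L1 i + L2 i) i = F L1 i + F L2 i" if "i \<in> {1..max m k}" for i
      unfolding F_def by (rule frob_add[of _ "(2 * q) ^ i"])
        (use psd[of i] that kron_pow_carrier[OF U] in \<open>auto simp: psd_mats_def\<close>)
    then have "(\<Sum>i=1..max m k. F (\<lambda>i. L1 i + L2 i) i) = (\<Sum>i=1..max m k. F L1 i + F L2 i)"
      by (rule sum.cong[OF refl])
    also have "\<dots> = (\<Sum>i=1..m. F L i) + kron_form (Gtilde G) k v"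
      by (simp only: sum.distrib F1 F2)
    finally have "kron_form (Gtilde G) k v + p = pconst l + (\<Sum>i=1..max m k. F (\<lambda>i. L1 i + L2 i) i)"
      by (simp add: p_eq F_def)
    moreover have "\<forall>i\<in>{1..max m k}. L1 i + L2 i \<in> psd_mats ((2 * q) ^ i)"
      using psd psd_add by auto
    ultimately show ?thesis
      unfolding HG_def q F_def using l
      by (intro CollectI exI[of _ l] exI[of _ "max m k"] exI[of _ "\<lambda>i. L1 i + L2 i"] conjI)
  qed
qed

lemma kron_cone_subset_HG:
  assumes G: "G \<in> carrier_mat q q"
  shows "kron_cone (Gtilde G) \<subseteq> HG G"
proof
  fix p assume "p \<in> kron_cone (Gtilde G)"
  then show "p \<in> HG G"
  proof induction
    case zero
    have "(0 :: 'a rpoly) = pconst 0 + (\<Sum>k=1..0. frob (map_mat pconst (0\<^sub>m 0 0)) (kron_pow (Gtilde G) k))"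
      by (simp add: pconst_0)
    then show ?case
      unfolding HG_def by fastforce
  next
    case (step p k v)
    then show ?case
      using kron_form_add_mem_HG[OF G] by blast
  qed
qed

lemma HG_subset_kron_bounded:
  assumes G: "G \<in> carrier_mat q q"
  shows "HG G \<subseteq> kron_bounded (Gtilde G)"
proof
  fix p assume "p \<in> HG G"
  then obtain l m L where p: "p = pconst l + (\<Sum>i=1..m. frob (map_mat pconst (L i)) (kron_pow (Gtilde G) i))"
    and L: "\<And>i. i \<in> {1..m} \<Longrightarrow> L i \<in> psd_mats ((2 * q) ^ i)"
    using G unfolding HG_def by auto
  show "p \<in> kron_bounded (Gtilde G)"
    unfolding p
    by (intro kron_bounded_add kron_bounded_pconst kron_bounded_sum
        kron_bounded_frob[OF Gtilde_carrier[OF G] trace_Gtilde[OF G]])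
      (use L in \<open>auto simp: psd_mats_def\<close>)
qed

text \<open>Vectors supported on the first \<open>q\<close> coordinates only see the block \<open>G\<close> of \<open>Gtilde G\<close>.\<close>

lemma pmat_eval_psd_of_ring_hom:
  fixes \<phi> :: "'n::finite rpoly \<Rightarrow> real"
  assumes G: "G \<in> carrier_mat q q" "transpose_mat G = G"
    and add: "\<And>a b. \<phi> (a + b) = \<phi> a + \<phi> b" and mult: "\<And>a b. \<phi> (a * b) = \<phi> a * \<phi> b"
    and const: "\<And>r. \<phi> (pconst r) = r"
    and nonneg: "\<And>v. 0 \<le> \<phi> (kron_form (Gtilde G) 1 v)"
  shows "pmat_eval G (vec_lambda (\<lambda>i. \<phi> (pvar i))) \<in> psd_mats q"
proof -
  define x where "x = vec_lambda (\<lambda>i. \<phi> (pvar i))"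
  have eval: "peval p x = \<phi> p" for p
    unfolding x_def by (rule ring_hom_eq_peval[OF add mult const, symmetric])
  have sum: "\<phi> (sum g A) = (\<Sum>i\<in>A. \<phi> (g i))" for g :: "nat \<Rightarrow> 'n rpoly" and A
    by (induction A rule: infinite_finite_induct) (simp_all add: add const[of 0, unfolded pconst_0])
  have U: "dim_row (Gtilde G) = 2 * q"
    using Gtilde_carrier[OF G(1)] by simp
  have "0 \<le> scalar_prod u (pmat_eval G x *\<^sub>v u)" if u: "u \<in> carrier_vec q" for u
  proof -
    define v where "v i = (if i < q then vec_index u i else 0)" for i
    have "\<phi> (kron_form (Gtilde G) 1 v) =
        (\<Sum>i<2 * q. \<Sum>j<2 * q. v i * v j * \<phi> (Gtilde G $$ (i, j)))"
      unfolding kron_form_def U power_one_right sum mult const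
      by (intro sum.cong refl arg_cong2[of _ _ _ _ "(*)"] arg_cong[of _ _ \<phi>]
          kron_pow_1_index[OF Gtilde_carrier[OF G(1)]]) auto
    also have "\<dots> = (\<Sum>i<q. \<Sum>j<2 * q. v i * v j * \<phi> (Gtilde G $$ (i, j)))"
      by (rule sum.mono_neutral_right) (auto simp: v_def)
    also have "\<dots> = (\<Sum>i<q. \<Sum>j<q. v i * v j * \<phi> (Gtilde G $$ (i, j)))"
      by (intro sum.cong refl sum.mono_neutral_right) (auto simp: v_def)
    also have "\<dots> = (\<Sum>i<q. vec_index u i * (\<Sum>j<q. \<phi> (G $$ (i, j)) * vec_index u j))"
      unfolding sum_distrib_left
      by (intro sum.cong refl) (simp add: v_def Gtilde_upper_left[OF G(1)])
    also have "\<dots> = scalar_prod u (pmat_eval G x *\<^sub>v u)"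
      using G(1) u by (simp add: scalar_prod_def pmat_eval_def lessThan_atLeast0 eval)
    finally show ?thesis
      using nonneg by metis
  qed
  moreover have "transpose_mat (pmat_eval G x) = pmat_eval G x"
    using G by (metis pmat_eval_def map_mat_transpose)
  ultimately show ?thesis
    using G(1) unfolding x_def by (auto simp: psd_mats_def pmat_eval_def)
qed

theorem theorem3p17:
  fixes q :: nat
    and G :: "'n::finite rpoly mat"
    and f :: "'n rpoly"
    and K :: "(real ^ 'n) set"
  assumes "G \<in> carrier_mat q q"
    and "transpose_mat G = G"
    and "\<not> linear_pmat q G"
    and "K = {x. pmat_eval G x \<in> psd_mats q}"
    and "compact K"
    and "\<forall>x\<in>K. 1\<^sub>m q - pmat_eval G x \<in> psd_mats q"
    and "\<forall>p :: 'n rpoly. \<exists>a\<in>HG G. \<exists>b\<in>HG G. p = a - b"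
    and "\<forall>x\<in>K. 0 < peval f x"
  shows "f \<in> HG G"
proof -
  note G = assms(1,2)
  note U = Gtilde_carrier[OF G(1)]
  interpret archimedean_semiring pconst "kron_cone (Gtilde G)"
  proof
    fix a
    obtain b b' where "b \<in> HG G" "b' \<in> HG G" "a = b - b'"
      using assms(7) by blast
    then have "a \<in> kron_bounded (Gtilde G)"
      using HG_subset_kron_bounded[OF G(1)] kron_bounded_diff by blast
    then show "\<exists>r. pconst r - a \<in> kron_cone (Gtilde G)"
      unfolding kron_bounded_def by blast
  qed (simp_all add: pconst_1 pconst_add pconst_mult pconst_mem_kron_cone kron_cone_add
      kron_cone_mult[OF U])
  have "f \<in> kron_cone (Gtilde G)"
  proof (rule positive_on_characters_imp_mem)
    fix \<phi> assume \<phi>: "character \<phi>"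
    then have hom: "\<phi> (a + b) = \<phi> a + \<phi> b" "\<phi> (a * b) = \<phi> a * \<phi> b" "\<phi> (pconst r) = r" for a b r
      unfolding character_def by blast+
    have "pmat_eval G (vec_lambda (\<lambda>i. \<phi> (pvar i))) \<in> psd_mats q"
      by (rule pmat_eval_psd_of_ring_hom[OF G hom])
         (use \<phi> kron_form_mem in \<open>unfold character_def, blast\<close>)
    then show "0 < \<phi> f"
      using assms(4,8) ring_hom_eq_peval[OF hom, of f] by fastforce
  qed
  then show ?thesis
    using kron_cone_subset_HG[OF G(1)] by blast
qed

end
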